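(* Let $\mu_n=\sum_{i=1}^mw_i\mu_n^{(i)}$ be a mixture of probability measures on $\mathbb{R}^d$ ($w_i>0$, $\sum_iw_i=1$), let $\sigma>0$ and $0<\beta_1<\dots<\beta_{n-1}$, and let $\varphi_k$ be the Gaussian probability density with $\varphi_k(x)\propto e^{-\beta_k\|x\|^2/(2\sigma^2)}$. Then for every $2\le k\le n-1$ and every $x\in\mathbb{R}^d$, $$\frac{(\mu_n*\varphi_k)(x)}{(\mu_n*\varphi_{k-1})(x)}\le\left(\frac{\beta_k}{\beta_{k-1}}\right)^{d/2}.$$
   Context: $\mu*\varphi$ denotes the density $x\mapsto\int\varphi(x-y)\,\mu(dy)$. *)

theory Defs
  imports "HOL-Probability.Probability"
begin

definition mixture :: "nat \<Rightarrow> (nat \<Rightarrow> real) \<Rightarrow> (nat \<Rightarrow> 'a::topological_space measure) \<Rightarrow> 'a measure" where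
  "mixture m w \<nu> =
     measure_of UNIV (sets borel) (\<lambda>A. \<Sum>i\<in>{1..m}. ennreal (w i) * emeasure (\<nu> i) A)"

definition gaussian_density :: "real \<Rightarrow> real \<Rightarrow> 'a::euclidean_space \<Rightarrow> real" where
  "gaussian_density b s x =
     exp (- b * (norm x)\<^sup>2 / (2 * s\<^sup>2)) /
     (\<integral>y. exp (- b * (norm y)\<^sup>2 / (2 * s\<^sup>2)) \<partial>(lborel :: 'a measure))"

definition conv_density :: "'a::euclidean_space measure \<Rightarrow> ('a \<Rightarrow> real) \<Rightarrow> 'a \<Rightarrow> real" where
  "conv_density M f x = (\<integral>y. f (x - y) \<partial>M)"

lemma sets_mixture [simp, measurable_cong]: "sets (mixture m w (\<nu> :: nat \<Rightarrow> 'a::topological_space measure)) = sets borel"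
  using sets.sigma_sets_eq[of "borel :: 'a measure"] by (simp add: mixture_def)

lemma space_mixture [simp]: "space (mixture m w \<nu>) = UNIV"
  by (simp add: mixture_def space_measure_of_conv)

lemma emeasure_mixture:
  assumes "\<And>i. i \<in> {1..m} \<Longrightarrow> sets (\<nu> i) = sets borel" and "A \<in> sets borel"
  shows "emeasure (mixture m w \<nu>) A = (\<Sum>i\<in>{1..m}. ennreal (w i) * emeasure (\<nu> i) A)"
proof (rule emeasure_measure_of[OF mixture_def])
  show "countably_additive (sets (mixture m w \<nu>))
          (\<lambda>A. \<Sum>i\<in>{1..m}. ennreal (w i) * emeasure (\<nu> i) A)"
  proof (rule countably_additiveI)
    fix B :: "nat \<Rightarrow> 'a set"
    assume B: "range B \<subseteq> sets (mixture m w \<nu>)" "disjoint_family B"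
    have "(\<Sum>j. \<Sum>i\<in>{1..m}. ennreal (w i) * emeasure (\<nu> i) (B j))
        = (\<Sum>i\<in>{1..m}. \<Sum>j. ennreal (w i) * emeasure (\<nu> i) (B j))"
      by (rule suminf_sum) auto
    also have "\<dots> = (\<Sum>i\<in>{1..m}. ennreal (w i) * emeasure (\<nu> i) (\<Union>j. B j))"
      using B assms(1) by (intro sum.cong refl) (simp add: suminf_emeasure)
    finally show "(\<Sum>j. \<Sum>i\<in>{1..m}. ennreal (w i) * emeasure (\<nu> i) (B j))
        = (\<Sum>i\<in>{1..m}. ennreal (w i) * emeasure (\<nu> i) (\<Union>j. B j))" .
  qed
qed (use assms in \<open>auto simp: positive_def\<close>)

lemma prob_space_mixture:
  assumes "\<And>i. i \<in> {1..m} \<Longrightarrow> prob_space (\<nu> i)"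
    and "\<And>i. i \<in> {1..m} \<Longrightarrow> sets (\<nu> i) = sets borel"
    and "\<And>i. i \<in> {1..m} \<Longrightarrow> 0 \<le> w i" and "(\<Sum>i\<in>{1..m}. w i) = 1"
  shows "prob_space (mixture m w \<nu>)"
proof
  have "emeasure (\<nu> i) UNIV = 1" if "i \<in> {1..m}" for i
    using prob_space.emeasure_space_1[OF assms(1)[OF that]] sets_eq_imp_space_eq[OF assms(2)[OF that]]
    by simp
  then have "emeasure (mixture m w \<nu>) UNIV = (\<Sum>i\<in>{1..m}. ennreal (w i))"
    using assms(2) by (subst emeasure_mixture) auto
  also have "\<dots> = 1"
    using assms(3,4) by (subst sum_ennreal) auto
  finally show "emeasure (mixture m w \<nu>) (space (mixture m w \<nu>)) = 1" by simp
qed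

lemma integrable_gaussian_exp:
  assumes "0 < b" "0 < s"
  shows "integrable lborel (\<lambda>x::'a::euclidean_space. exp (- b * (norm x)\<^sup>2 / (2 * s\<^sup>2)))"
proof -
  interpret product_sigma_finite "\<lambda>_::'a. lborel :: real measure" ..
  define t where "t = s / sqrt b"
  have t: "0 < t" "b / s\<^sup>2 = 1 / t\<^sup>2"
    using assms by (auto simp: t_def power_divide)
  define g :: "real \<Rightarrow> real" where "g u = exp (- b * u\<^sup>2 / (2 * s\<^sup>2))" for u
  have "g = (\<lambda>u. sqrt (2 * pi * t\<^sup>2) * normal_density 0 t u)"
    using assms t by (auto simp: g_def normal_density_def t_def power_divide fun_eq_iff field_simps)
  then have g: "integrable lborel g"
    using t by (simp add: integrable_normal_density)
  have eq: "(\<Prod>c\<in>Basis. g (f c)) = exp (- b * (norm (\<Sum>c\<in>Basis. f c *\<^sub>R c :: 'a))\<^sup>2 / (2 * s\<^sup>2))"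
    for f :: "'a \<Rightarrow> real"
  proof -
    have "(norm (\<Sum>c\<in>Basis. f c *\<^sub>R c :: 'a))\<^sup>2 = (\<Sum>c\<in>Basis. (f c)\<^sup>2)"
      unfolding power2_norm_eq_inner
      by (subst euclidean_inner) (simp add: inner_sum_left inner_Basis if_distrib power2_eq_square cong: if_cong)
    then show ?thesis
      by (simp add: g_def exp_sum[symmetric] sum_distrib_left sum_divide_distrib sum_negf)
  qed
  have "integrable (Pi\<^sub>M Basis (\<lambda>_::'a. lborel)) (\<lambda>f. \<Prod>c\<in>Basis. g (f c))"
    using g by (intro product_integrable_prod) auto
  then show ?thesis
    unfolding eq lborel_eq[where 'a = 'a] by (subst integrable_distr_eq) auto
qed

lemma prob_space_gaussian_density:
  assumes "0 < b" "0 < s"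
  shows "prob_space (density lborel (gaussian_density b s :: 'a::euclidean_space \<Rightarrow> real))"
proof
  let ?g = "\<lambda>x::'a. exp (- b * (norm x)\<^sup>2 / (2 * s\<^sup>2))"
  note int = integrable_gaussian_exp[OF assms, where 'a = 'a]
  have "integral\<^sup>L lborel ?g \<noteq> 0"
    using integral_nonneg_eq_0_iff_AE[OF int] by (simp add: AE_iff_measurable[OF _ refl])
  moreover have "integral\<^sup>L lborel ?g \<ge> 0"
    by (simp add: integral_nonneg_AE)
  ultimately have pos: "integral\<^sup>L lborel ?g > 0" by linarith
  have "(\<integral>\<^sup>+x. ennreal (gaussian_density b s x) \<partial>(lborel::'a measure)) = ennreal (\<integral>x. ?g x / integral\<^sup>L lborel ?g \<partial>lborel)"
    unfolding gaussian_density_def using int pos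
    by (intro nn_integral_eq_integral) auto
  also have "\<dots> = 1" using pos by simp
  finally show "emeasure (density lborel (gaussian_density b s :: 'a \<Rightarrow> real)) (space (density lborel (gaussian_density b s))) = 1"
    by (subst emeasure_density) (auto simp: gaussian_density_def)
qed

end

theory Submission
  imports Defs
begin

text \<open>
  The unnormalised kernels decrease in \<open>b\<close>, so the ratio of two Gaussian densities is bounded
  pointwise by the ratio of their normalising constants, which scaling computes as a power of the
  ratio of the parameters. Integrating against \<open>\<mu>\<close> preserves the pointwise bound.
\<close>

text \<open>Change of variables for a dilation: \<open>lborel_affine\<close> with zero translation
  presents Lebesgue measure as its own image under scaling by \<open>c\<close>, weighted by the
  constant Jacobian factor, which then comes out of the integral.\<close>

lemma lborel_integral_scaleR:
  fixes f :: "'a::euclidean_space \<Rightarrow> real"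
  assumes [measurable]: "f \<in> borel_measurable borel" and c: "c \<noteq> 0"
  shows "(\<integral>x. f x \<partial>lborel) = \<bar>c\<bar> ^ DIM('a) * (\<integral>x. f (c *\<^sub>R x) \<partial>lborel)"
  by (subst lborel_affine[OF c, of 0])
    (simp add: integral_density integral_distr)

text \<open>Substituting \<open>c *\<^sub>R y\<close> for \<open>y\<close> with
  \<open>c = sqrt (b' / b)\<close> turns the parameter \<open>b\<close> into
  \<open>b * c\<^sup>2 = b'\<close>, and the Jacobian \<open>c ^ DIM('a)\<close> is the stated
  power. Comparing the two integrals in this way avoids evaluating either of them.\<close>

lemma gaussian_integral_scaling:
  fixes b b' s :: real
  assumes "0 < b" "0 < b'"
  shows "(\<integral>y. exp (- b * (norm y)\<^sup>2 / (2 * s\<^sup>2)) \<partial>(lborel :: 'a::euclidean_space measure)) =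
    (b' / b) powr (real DIM('a) / 2) *
    (\<integral>y. exp (- b' * (norm y)\<^sup>2 / (2 * s\<^sup>2)) \<partial>(lborel :: 'a measure))"
proof -
  define c where "c = sqrt (b' / b)"
  have c: "c > 0" "b * c\<^sup>2 = b'"
    using assms by (auto simp: c_def)
  have "exp (- b * (norm (c *\<^sub>R y))\<^sup>2 / (2 * s\<^sup>2)) = exp (- b' * (norm y)\<^sup>2 / (2 * s\<^sup>2))" for y :: 'a
    by (simp add: power_mult_distrib c(2)[symmetric] mult.assoc)
  moreover have "\<bar>c\<bar> ^ DIM('a) = (b' / b) powr (real DIM('a) / 2)"
    using assms c(1) by (simp add: c_def powr_half_sqrt[symmetric] powr_powr flip: powr_realpow)
  ultimately show ?thesis
    using c(1) by (subst lborel_integral_scaleR[where c = c]) (simp_all only:, simp)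
qed

lemma gaussian_density_nonneg: "0 \<le> gaussian_density b s x"
  by (simp add: gaussian_density_def)

lemma gaussian_density_le:
  fixes x :: "'a::euclidean_space"
  assumes "0 < b" "b \<le> b'"
  shows "gaussian_density b' s x \<le> (b' / b) powr (real DIM('a) / 2) * gaussian_density b s x"
proof -
  let ?Z = "\<lambda>b. \<integral>y. exp (- b * (norm y)\<^sup>2 / (2 * s\<^sup>2)) \<partial>(lborel :: 'a measure)"
  let ?r = "(b' / b) powr (real DIM('a) / 2)"
  have "?r > 0"
    using assms by simp
  \<comment> \<open>Only the numerator changes here: the exponential decreases in the parameter,
    while the normalising constant stays that of \<open>b'\<close>.\<close>
  have "gaussian_density b' s x \<le> exp (- b * (norm x)\<^sup>2 / (2 * s\<^sup>2)) / ?Z b'"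
    unfolding gaussian_density_def using assms
    by (intro divide_right_mono) (auto intro!: divide_right_mono mult_right_mono)
  \<comment> \<open>Now the constant is exchanged: \<open>?Z b = ?r * ?Z b'\<close>, and
    \<open>?r\<close> cancels because it is nonzero.\<close>
  also have "\<dots> = ?r * gaussian_density b s x"
    unfolding gaussian_density_def
    using gaussian_integral_scaling[of b b' s, where 'a = 'a] assms \<open>?r > 0\<close> by simp
  finally show ?thesis .
qed

lemma borel_measurable_gaussian_density [measurable]:
  "gaussian_density b s \<in> borel_measurable (borel :: 'a::euclidean_space measure)"
  unfolding gaussian_density_def by measurable

text \<open>The kernel attains its maximum at the origin, so it is bounded, and a bounded measurable
  function is integrable over a finite measure. Monotonicity of the Bochner integral relies on this
  below.\<close>

lemma integrable_gaussian_density_shift: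
  fixes M :: "'a::euclidean_space measure"
  assumes "finite_measure M" "sets M = sets borel" "0 \<le> b"
  shows "integrable M (\<lambda>y. gaussian_density b s (x - y))"
proof (rule finite_measure.integrable_const_bound[OF assms(1)])
  note [measurable_cong] = assms(2)
  show "AE y in M. norm (gaussian_density b s (x - y)) \<le> gaussian_density b s (0 :: 'a)"
    using assms(3)
    by (auto simp: gaussian_density_nonneg) (auto simp: gaussian_density_def intro!: divide_right_mono)
  show "(\<lambda>y. gaussian_density b s (x - y)) \<in> borel_measurable M"
    by measurable
qed

lemma conv_density_gaussian_ratio_le:
  fixes M :: "'a::euclidean_space measure"
  assumes "finite_measure M" "sets M = sets borel" "0 < b" "b \<le> b'"
  shows "conv_density M (gaussian_density b' s) x / conv_density M (gaussian_density b s) x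
    \<le> (b' / b) powr (real DIM('a) / 2)"
proof -
  have "conv_density M (gaussian_density b' s) x
      \<le> (\<integral>y. (b' / b) powr (real DIM('a) / 2) * gaussian_density b s (x - y) \<partial>M)"
    unfolding conv_density_def using assms
    by (intro integral_mono integrable_mult_right integrable_gaussian_density_shift gaussian_density_le)
      auto
  also have "\<dots> = (b' / b) powr (real DIM('a) / 2) * conv_density M (gaussian_density b s) x"
    by (simp add: conv_density_def)
  finally have "conv_density M (gaussian_density b' s) x
      \<le> (b' / b) powr (real DIM('a) / 2) * conv_density M (gaussian_density b s) x" .
  moreover have "0 \<le> conv_density M (gaussian_density b s) x"
    by (simp add: conv_density_def gaussian_density_nonneg)
  \<comment> \<open>For a positive denominator this is division of the previous inequality. For a
    zero denominator the quotient is 0 by convention, and the bound is nonnegative.\<close>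
  ultimately show ?thesis
    by (cases "conv_density M (gaussian_density b s) x = 0") (simp_all add: divide_le_eq)
qed

theorem proposition12:
  fixes n m :: nat
    and w \<beta> :: "nat \<Rightarrow> real"
    and \<nu> :: "nat \<Rightarrow> 'a::euclidean_space measure"
    and \<mu> :: "'a measure"
    and \<sigma> :: real
  assumes "\<And>i. i \<in> {1..m} \<Longrightarrow> prob_space (\<nu> i)"
    and "\<And>i. i \<in> {1..m} \<Longrightarrow> sets (\<nu> i) = sets borel"
    and "\<And>i. i \<in> {1..m} \<Longrightarrow> w i > 0"
    and "(\<Sum>i\<in>{1..m}. w i) = 1"
    and "\<mu> = mixture m w \<nu>"
    and "\<sigma> > 0"
    and "\<And>k. k \<in> {1..n - 1} \<Longrightarrow> \<beta> k > 0"
    and "strict_mono_on {1..n - 1} \<beta>"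
  shows "\<forall>k\<in>{2..n - 1}. \<forall>x.
           conv_density \<mu> (gaussian_density (\<beta> k) \<sigma>) x /
           conv_density \<mu> (gaussian_density (\<beta> (k - 1)) \<sigma>) x
           \<le> (\<beta> k / \<beta> (k - 1)) powr (real DIM('a) / 2)"
proof (intro ballI allI)
  fix k x
  assume k: "k \<in> {2..n - 1}"
  \<comment> \<open>Since \<open>k\<close> is at least 2, the truncated subtraction is genuine and
    \<open>k - 1\<close> stays in the range where \<beta> is positive and increasing.\<close>
  then have k1: "k - 1 \<in> {1..n - 1}" and k2: "k \<in> {1..n - 1}" and "k - 1 < k"
    by auto
  have "\<beta> (k - 1) > 0"
    using k1 by (rule assms(7))
  moreover have "\<beta> (k - 1) < \<beta> k"
    using assms(8) k1 k2 \<open>k - 1 < k\<close> by (rule strict_mono_onD)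
  \<comment> \<open>Positive weights summing to 1 make the mixture a probability measure, hence a
    finite one, as the general ratio bound requires.\<close>
  moreover have "prob_space \<mu>"
    unfolding assms(5) using assms(1,2) less_imp_le[OF assms(3)] assms(4)
    by (rule prob_space_mixture)
  moreover have "sets \<mu> = sets borel"
    unfolding assms(5) by (rule sets_mixture)
  ultimately show "conv_density \<mu> (gaussian_density (\<beta> k) \<sigma>) x /
      conv_density \<mu> (gaussian_density (\<beta> (k - 1)) \<sigma>) x
      \<le> (\<beta> k / \<beta> (k - 1)) powr (real DIM('a) / 2)"
    by (intro conv_density_gaussian_ratio_le prob_space.finite_measure less_imp_le)
qed

end
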